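(* For each $n\ge 5$, the closed neighborhood ideal $NI(P_n)$ of the path graph $P_n$ is not a generic monomial ideal.
   Context: $P_n$ is the graph on $\{x_1,\dots,x_n\}$ with edges $\{x_i,x_{i+1}\}$, $1\le i\le n-1$. Its closed neighborhood ideal is $NI(P_n)=\langle\prod_{y\in N[v]}y: v\in V(P_n)\rangle\subseteq\mathbb{K}[x_1,\dots,x_n]$ ($\mathbb{K}$ a field), where $N[v]$ is $v$ together with its neighbors. For a monomial ideal $I$, $\mathcal{G}(I)$ is its set of minimal monomial generators. For a monomial $m$, $\mathrm{ord}_{x_i}(m)=\max\{k\in\mathbb{Z}: x_i^k\mid m\}$, and $\mathrm{ord}_{x_i}(I)=\min\{\mathrm{ord}_{x_i}(m): m\in\mathcal{G}(I)\}$. A monomial ideal $I$ is generic if whenever $\mathrm{ord}_{x_i}(m)=\mathrm{ord}_{x_i}(m')>\mathrm{ord}_{x_i}(I)$ for some variable $x_i$ and (distinct) $m,m'\in\mathcal{G}(I)$, there exists a third generator $m''\in\mathcal{G}(I)\setminus\{m,m'\}$ such that $m''\mid\mathrm{lcm}(m,m')$. *)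

theory Defs
  imports "HOL-Library.Poly_Mapping" "HOL-Algebra.Ideal" "HOL-Algebra.Divisibility"
begin

section \<open>Polynomial rings and monomials\<close>

text \<open>
  A polynomial with variables indexed by \<^typ>\<open>'v\<close> is a finitely supported map from exponent
  vectors to coefficients; multiplication on this type is convolution.
\<close>

type_synonym ('v, 'k) mpoly = "('v \<Rightarrow>\<^sub>0 nat) \<Rightarrow>\<^sub>0 'k"

text \<open>The ring of polynomials in the variables indexed by \<open>V\<close> only.\<close>

definition poly_ring :: "'v set \<Rightarrow> ('v, 'k::field) mpoly ring" where
  "poly_ring V =
     \<lparr>carrier = {p. \<forall>a \<in> Poly_Mapping.keys p. Poly_Mapping.keys a \<subseteq> V},
      monoid.mult = (*), one = 1, zero = 0, add = (+)\<rparr>"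

definition var :: "'v \<Rightarrow> ('v, 'k::field) mpoly" where
  "var v = Poly_Mapping.single (Poly_Mapping.single v 1) 1"

definition monomials :: "'v set \<Rightarrow> ('v, 'k::field) mpoly set" where
  "monomials V = {Poly_Mapping.single a 1 | a. Poly_Mapping.keys a \<subseteq> V}"

section \<open>Generic monomial ideals\<close>

definition monomial_ideal :: "'v set \<Rightarrow> ('v, 'k::field) mpoly set \<Rightarrow> bool" where
  "monomial_ideal V I \<longleftrightarrow> (\<exists>S \<subseteq> monomials V. I = Idl\<^bsub>poly_ring V\<^esub> S)"

text \<open>
  The monomials of \<open>I\<close> that are minimal with respect to divisibility. For a monomial ideal this is
  its unique minimal set of monomial generators; see \<open>min_gens_generate\<close> and \<open>min_gens_least\<close>.
\<close>

definition min_gens :: "'v set \<Rightarrow> ('v, 'k::field) mpoly set \<Rightarrow> ('v, 'k) mpoly set" where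
  "min_gens V I = {m \<in> I \<inter> monomials V.
     \<forall>m' \<in> I \<inter> monomials V. m' divides\<^bsub>poly_ring V\<^esub> m \<longrightarrow> m' = m}"

definition var_ord :: "'v set \<Rightarrow> 'v \<Rightarrow> ('v, 'k::field) mpoly \<Rightarrow> nat" where
  "var_ord V v m = Max {k. var v ^ k divides\<^bsub>poly_ring V\<^esub> m}"

definition ideal_ord :: "'v set \<Rightarrow> 'v \<Rightarrow> ('v, 'k::field) mpoly set \<Rightarrow> nat" where
  "ideal_ord V v I = (INF m \<in> min_gens V I. var_ord V v m)"

text \<open>
  Meant for monomial ideals \<open>I\<close>. The choice made by \<^const>\<open>somelcm\<close> is determined up to a
  nonzero scalar, which does not affect divisibility.
\<close>

definition generic_ideal :: "'v set \<Rightarrow> ('v, 'k::field) mpoly set \<Rightarrow> bool" where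
  "generic_ideal V I \<longleftrightarrow>
     (\<forall>v \<in> V. \<forall>m \<in> min_gens V I. \<forall>m' \<in> min_gens V I.
        m \<noteq> m' \<and> var_ord V v m = var_ord V v m' \<and> var_ord V v m > ideal_ord V v I \<longrightarrow>
        (\<exists>m'' \<in> min_gens V I - {m, m'}.
           m'' divides\<^bsub>poly_ring V\<^esub> somelcm (poly_ring V) m m'))"

section \<open>Closed neighborhood ideals of graphs\<close>

text \<open>A simple graph is a pair of a vertex set and a set of two-element edges.\<close>

type_synonym 'v graph = "'v set \<times> 'v set set"

definition closed_nbhd :: "'v graph \<Rightarrow> 'v \<Rightarrow> 'v set" where
  "closed_nbhd G v = insert v {u \<in> fst G. {u, v} \<in> snd G}"

definition closed_nbhd_ideal :: "'v graph \<Rightarrow> ('v, 'k::field) mpoly set" where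
  "closed_nbhd_ideal G =
     Idl\<^bsub>poly_ring (fst G)\<^esub> ((\<lambda>v. \<Prod>y \<in> closed_nbhd G v. var y) ` fst G)"

definition path_graph :: "nat \<Rightarrow> nat graph" where
  "path_graph n = ({1..n}, {{i, i + 1} | i. 1 \<le> i \<and> i + 1 \<le> n})"

section \<open>Basic facts\<close>

lemma poly_ring_simps [simp]:
  "monoid.mult (poly_ring V) = (*)" "one (poly_ring V) = 1"
  "zero (poly_ring V) = 0" "add (poly_ring V) = (+)"
  by (simp_all add: poly_ring_def)

lemma mem_poly_ring_iff:
  "p \<in> carrier (poly_ring V) \<longleftrightarrow> (\<forall>a \<in> Poly_Mapping.keys p. Poly_Mapping.keys a \<subseteq> V)"
  by (simp add: poly_ring_def)

lemma keys_add_exp: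
  "Poly_Mapping.keys (a + b :: 'v \<Rightarrow>\<^sub>0 nat) = Poly_Mapping.keys a \<union> Poly_Mapping.keys b"
  by (auto simp: in_keys_iff lookup_add)

lemma cring_poly_ring: "cring (poly_ring V :: ('v, 'k::field) mpoly ring)"
proof (rule cringI)
  show "abelian_group (poly_ring V :: ('v, 'k) mpoly ring)"
  proof (rule abelian_groupI)
    fix x y :: "('v, 'k) mpoly"
    assume xy: "x \<in> carrier (poly_ring V)" "y \<in> carrier (poly_ring V)"
    show "x \<oplus>\<^bsub>poly_ring V\<^esub> y \<in> carrier (poly_ring V)"
      using xy keys_add[of x y] by (auto simp: mem_poly_ring_iff)
    have "- x \<in> carrier (poly_ring V)"
      using xy(1) by (simp add: mem_poly_ring_iff)
    then show "\<exists>y \<in> carrier (poly_ring V). y \<oplus>\<^bsub>poly_ring V\<^esub> x = \<zero>\<^bsub>poly_ring V\<^esub>"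
      by (intro bexI[of _ "- x"]) auto
  qed (auto simp: mem_poly_ring_iff ac_simps)
  show "Group.comm_monoid (poly_ring V :: ('v, 'k) mpoly ring)"
  proof (rule comm_monoidI)
    fix x y :: "('v, 'k) mpoly"
    assume xy: "x \<in> carrier (poly_ring V)" "y \<in> carrier (poly_ring V)"
    show "x \<otimes>\<^bsub>poly_ring V\<^esub> y \<in> carrier (poly_ring V)"
      unfolding mem_poly_ring_iff
    proof
      fix c assume "c \<in> Poly_Mapping.keys (x \<otimes>\<^bsub>poly_ring V\<^esub> y)"
      then obtain a b where "a \<in> Poly_Mapping.keys x" "b \<in> Poly_Mapping.keys y" "c = a + b"
        using keys_mult[of x y] by auto
      then show "Poly_Mapping.keys c \<subseteq> V"
        using xy by (auto simp: mem_poly_ring_iff keys_add_exp)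
    qed
  qed (auto simp: mem_poly_ring_iff ac_simps)
qed (auto simp: algebra_simps)

lemma monomials_carrier: "monomials V \<subseteq> carrier (poly_ring V)"
  by (auto simp: monomials_def mem_poly_ring_iff)

lemma single_divides_single_iff:
  assumes "Poly_Mapping.keys b \<subseteq> V"
  shows "(Poly_Mapping.single a 1 :: ('v, 'k::field) mpoly)
           divides\<^bsub>poly_ring V\<^esub> Poly_Mapping.single b 1 \<longleftrightarrow>
         (\<forall>v. Poly_Mapping.lookup a v \<le> Poly_Mapping.lookup b v)"
proof
  assume "(Poly_Mapping.single a 1 :: ('v, 'k) mpoly)
            divides\<^bsub>poly_ring V\<^esub> Poly_Mapping.single b 1"
  then obtain c :: "('v, 'k) mpoly" where
    c: "Poly_Mapping.single b 1 = Poly_Mapping.single a 1 * c"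
    by (auto simp: factor_def)
  have "b \<in> Poly_Mapping.keys (Poly_Mapping.single a 1 * c)"
    by (simp flip: c)
  then obtain d where "b = a + d"
    using keys_mult[of "Poly_Mapping.single a 1" c] by auto
  then show "\<forall>v. Poly_Mapping.lookup a v \<le> Poly_Mapping.lookup b v"
    by (simp add: lookup_add)
next
  assume le: "\<forall>v. Poly_Mapping.lookup a v \<le> Poly_Mapping.lookup b v"
  define c where "c = b - a"
  have "b = a + c"
    using le by (intro poly_mapping_eqI) (simp add: c_def lookup_add lookup_minus)
  moreover have "Poly_Mapping.single c (1 :: 'k) \<in> carrier (poly_ring V)"
    using assms calculation by (simp add: mem_poly_ring_iff keys_add_exp)
  ultimately show "(Poly_Mapping.single a 1 :: ('v, 'k) mpoly)
            divides\<^bsub>poly_ring V\<^esub> Poly_Mapping.single b 1"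
    unfolding factor_def by (intro bexI[of _ "Poly_Mapping.single c 1"]) (auto simp: mult_single)
qed

lemma monomial_in_genideal:
  fixes S :: "('v, 'k::field) mpoly set"
  assumes S: "S \<subseteq> monomials V" and m: "m \<in> monomials V" "m \<in> Idl\<^bsub>poly_ring V\<^esub> S"
  shows "\<exists>s \<in> S. s divides\<^bsub>poly_ring V\<^esub> m"
proof -
  interpret cring "poly_ring V :: ('v, 'k) mpoly ring"
    by (rule cring_poly_ring)
  define D where "D a \<longleftrightarrow> (\<exists>s \<in> S. s divides\<^bsub>poly_ring V\<^esub> (Poly_Mapping.single a 1 :: ('v, 'k) mpoly))" for a
  define J where "J = {p \<in> carrier (poly_ring V :: ('v, 'k) mpoly ring). \<forall>a \<in> Poly_Mapping.keys p. D a}"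
  have D_add: "D (b + a)" if "D a" "Poly_Mapping.keys b \<subseteq> V" for a b
  proof -
    obtain s c where s: "s \<in> S" "c \<in> carrier (poly_ring V)" "Poly_Mapping.single a 1 = s * c"
      using \<open>D a\<close> by (auto simp: D_def factor_def)
    have "Poly_Mapping.single (b + a) 1 = s * (Poly_Mapping.single b 1 * c)"
      using mult_single[of b 1 a "1 :: 'k"] s(3) by (simp add: mult.left_commute)
    moreover have "Poly_Mapping.single b 1 * c \<in> carrier (poly_ring V)"
      using m_closed[of "Poly_Mapping.single b 1" c] s(2) that(2)
      by (simp add: mem_poly_ring_iff)
    ultimately show ?thesis
      unfolding D_def factor_def using s(1) by auto
  qed
  have J_mult: "x * p \<in> J" if "p \<in> J" "x \<in> carrier (poly_ring V)" for x p :: "('v, 'k) mpoly"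
  proof -
    have "x * p \<in> carrier (poly_ring V)"
      using m_closed[of x p] that by (simp add: J_def)
    moreover have "D c" if c: "c \<in> Poly_Mapping.keys (x * p)" for c
    proof -
      obtain b a where "b \<in> Poly_Mapping.keys x" "a \<in> Poly_Mapping.keys p" "c = b + a"
        using c keys_mult[of x p] by auto
      then show ?thesis
        using \<open>p \<in> J\<close> \<open>x \<in> carrier (poly_ring V)\<close> D_add by (auto simp: J_def mem_poly_ring_iff)
    qed
    ultimately show ?thesis
      by (simp add: J_def)
  qed
  have "ideal J (poly_ring V)"
  proof (rule idealI)
    show "subgroup J (add_monoid (poly_ring V))"
    proof (rule add.subgroupI)
      show "J \<subseteq> carrier (poly_ring V)"
        by (auto simp: J_def)
      show "J \<noteq> {}"
        using zero_closed by (auto simp: J_def)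
    next
      fix p assume p: "p \<in> J"
      have "\<ominus>\<^bsub>poly_ring V\<^esub> p = - p"
        using p by (intro minus_equality) (auto simp: J_def mem_poly_ring_iff)
      then show "\<ominus>\<^bsub>poly_ring V\<^esub> p \<in> J"
        using p by (auto simp: J_def mem_poly_ring_iff)
    next
      fix p q assume "p \<in> J" "q \<in> J"
      then show "p \<oplus>\<^bsub>poly_ring V\<^esub> q \<in> J"
        using keys_add[of p q] a_closed[of p q] by (auto simp: J_def)
    qed
  next
    fix p x :: "('v, 'k) mpoly" assume "p \<in> J" "x \<in> carrier (poly_ring V)"
    then show "x \<otimes>\<^bsub>poly_ring V\<^esub> p \<in> J" "p \<otimes>\<^bsub>poly_ring V\<^esub> x \<in> J"
      using J_mult by (auto simp: mult.commute)
  qed (rule ring_axioms)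
  moreover have "S \<subseteq> J"
  proof
    fix s assume s: "s \<in> S"
    then obtain a where a: "s = Poly_Mapping.single a 1"
      using S by (auto simp: monomials_def)
    have "s divides\<^bsub>poly_ring V\<^esub> s"
      using s S monomials_carrier by (auto intro: divides_refl)
    then show "s \<in> J"
      using s S monomials_carrier a by (auto simp: J_def D_def)
  qed
  ultimately have "m \<in> J"
    using m(2) by (auto simp: genideal_def)
  then show ?thesis
    using m(1) by (auto simp: J_def D_def monomials_def)
qed

lemma min_gens_least:
  fixes S :: "('v, 'k::field) mpoly set"
  assumes "S \<subseteq> monomials V" "I = Idl\<^bsub>poly_ring V\<^esub> S"
  shows "min_gens V I \<subseteq> S"
proof
  interpret cring "poly_ring V :: ('v, 'k) mpoly ring"
    by (rule cring_poly_ring)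
  fix m assume m: "m \<in> min_gens V I"
  then obtain s where s: "s \<in> S" "s divides\<^bsub>poly_ring V\<^esub> m"
    using monomial_in_genideal[OF assms(1)] assms(2) by (auto simp: min_gens_def)
  have "s \<in> I"
    using s(1) assms genideal_self[of S] monomials_carrier by blast
  then show "m \<in> S"
    using m s assms(1) by (auto simp: min_gens_def)
qed

lemma min_gens_generate:
  fixes I :: "('v, 'k::field) mpoly set"
  assumes "monomial_ideal V I"
  shows "I = Idl\<^bsub>poly_ring V\<^esub> (min_gens V I)"
proof -
  interpret cring "poly_ring V :: ('v, 'k) mpoly ring"
    by (rule cring_poly_ring)
  obtain S where S: "S \<subseteq> monomials V" "I = Idl\<^bsub>poly_ring V\<^esub> S"
    using assms by (auto simp: monomial_ideal_def)
  have G: "min_gens V I \<subseteq> carrier (poly_ring V)"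
    using monomials_carrier by (auto simp: min_gens_def)
  define deg where "deg a = (\<Sum>v \<in> Poly_Mapping.keys a. Poly_Mapping.lookup a v)"
    for a :: "'v \<Rightarrow>\<^sub>0 nat"
  have deg_less: "deg a < deg b"
    if le: "\<forall>v. Poly_Mapping.lookup a v \<le> Poly_Mapping.lookup b v" and ne: "a \<noteq> b" for a b
  proof -
    obtain v where "Poly_Mapping.lookup a v \<noteq> Poly_Mapping.lookup b v"
      using ne poly_mapping_eqI[of a b] by blast
    then have v: "Poly_Mapping.lookup a v < Poly_Mapping.lookup b v"
      using le by (simp add: le_neq_implies_less)
    have "deg a = (\<Sum>v \<in> Poly_Mapping.keys b. Poly_Mapping.lookup a v)"
      unfolding deg_def
    proof (intro sum.mono_neutral_left)
      show "Poly_Mapping.keys a \<subseteq> Poly_Mapping.keys b"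
      proof
        fix u assume "u \<in> Poly_Mapping.keys a"
        then show "u \<in> Poly_Mapping.keys b"
          using le[rule_format, of u] by (simp add: in_keys_iff)
      qed
    qed (auto simp: in_keys_iff)
    also have "\<dots> < deg b"
      unfolding deg_def
    proof (intro sum_strict_mono_ex1)
      show "\<exists>v \<in> Poly_Mapping.keys b. Poly_Mapping.lookup a v < Poly_Mapping.lookup b v"
        using v by (intro bexI[of _ v]) (simp_all add: in_keys_iff)
    qed (simp_all add: le)
    finally show ?thesis .
  qed
  have ex: "\<exists>g \<in> min_gens V I. g divides\<^bsub>poly_ring V\<^esub> Poly_Mapping.single a 1"
    if "Poly_Mapping.single a 1 \<in> I" "Poly_Mapping.keys a \<subseteq> V" for a
    using that
  proof (induction "deg a" arbitrary: a rule: less_induct)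
    case less
    let ?m = "Poly_Mapping.single a 1 :: ('v, 'k) mpoly"
    have m: "?m \<in> I \<inter> monomials V" "?m \<in> carrier (poly_ring V)"
      using less.prems by (auto simp: monomials_def mem_poly_ring_iff)
    show ?case
    proof (cases "?m \<in> min_gens V I")
      case True
      then show ?thesis
        using divides_refl m(2) by blast
    next
      case False
      then obtain b where b: "Poly_Mapping.single b 1 \<in> I" "Poly_Mapping.keys b \<subseteq> V"
        "(Poly_Mapping.single b 1 :: ('v, 'k) mpoly) divides\<^bsub>poly_ring V\<^esub> ?m" "b \<noteq> a"
        using m by (auto simp: min_gens_def monomials_def)
      then have "deg b < deg a"
        using deg_less less.prems(2) single_divides_single_iff by blast
      then obtain g where "g \<in> min_gens V I"
        "g divides\<^bsub>poly_ring V\<^esub> Poly_Mapping.single b 1"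
        using less.hyps b by blast
      then show ?thesis
        using b(3) G divides_trans by blast
    qed
  qed
  have "S \<subseteq> Idl\<^bsub>poly_ring V\<^esub> (min_gens V I)"
  proof
    fix s assume s: "s \<in> S"
    then have "s \<in> I"
      using S genideal_self[of S] monomials_carrier by blast
    then obtain g c where g: "g \<in> min_gens V I" "c \<in> carrier (poly_ring V)" "s = g * c"
      using ex s S(1) by (fastforce simp: monomials_def factor_def)
    then show "s \<in> Idl\<^bsub>poly_ring V\<^esub> (min_gens V I)"
      using ideal.I_r_closed[OF genideal_ideal[OF G], of g c] genideal_self[OF G] by auto
  qed
  then have "I \<subseteq> Idl\<^bsub>poly_ring V\<^esub> (min_gens V I)"
    using S(2) genideal_minimal[OF genideal_ideal[OF G]] by blast
  moreover have "ideal I (poly_ring V)"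
    using S genideal_ideal monomials_carrier by blast
  then have "Idl\<^bsub>poly_ring V\<^esub> (min_gens V I) \<subseteq> I"
    by (rule genideal_minimal) (auto simp: min_gens_def)
  ultimately show ?thesis
    by blast
qed

lemma prod_var_monomials:
  assumes "finite A" "A \<subseteq> V"
  shows "(\<Prod>y \<in> A. var y :: ('v, 'k::field) mpoly) \<in> monomials V"
  using assms
proof (induction A rule: finite_induct)
  case empty
  have "(1 :: ('v, 'k) mpoly) = Poly_Mapping.single 0 1"
    by simp
  moreover have "Poly_Mapping.keys (0 :: 'v \<Rightarrow>\<^sub>0 nat) \<subseteq> V"
    by simp
  ultimately show ?case
    unfolding monomials_def prod.empty by blast
next
  case (insert x A)
  then obtain a where a: "(\<Prod>y \<in> A. var y) = (Poly_Mapping.single a 1 :: ('v, 'k) mpoly)"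
    "Poly_Mapping.keys a \<subseteq> V"
    by (auto simp: monomials_def)
  let ?b = "Poly_Mapping.single x 1 + a"
  have "(\<Prod>y \<in> insert x A. var y) = (Poly_Mapping.single ?b 1 :: ('v, 'k) mpoly)"
    using insert.hyps a(1) by (simp add: var_def mult_single)
  moreover have "Poly_Mapping.keys ?b \<subseteq> V"
    using insert.prems a(2) by (simp add: keys_add_exp)
  ultimately show ?case
    unfolding monomials_def by blast
qed

lemma monomial_ideal_closed_nbhd_ideal:
  assumes "finite (fst G)"
  shows "monomial_ideal (fst G) (closed_nbhd_ideal G :: ('v, 'k::field) mpoly set)"
proof -
  have "(\<Prod>y \<in> closed_nbhd G v. var y :: ('v, 'k) mpoly) \<in> monomials (fst G)" if "v \<in> fst G" for v
    using assms that by (intro prod_var_monomials) (auto simp: closed_nbhd_def)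
  then show ?thesis
    unfolding monomial_ideal_def closed_nbhd_ideal_def
    by (metis image_subsetI)
qed

end

theory Submission
  imports Defs
begin

text \<open>
  The generators \<open>x\<^sub>1x\<^sub>2\<close>, \<open>x\<^sub>2x\<^sub>3x\<^sub>4\<close> and \<open>x\<^bsub>n-1\<^esub>x\<^sub>n\<close>, coming from the
  vertices \<open>1\<close>, \<open>3\<close> and \<open>n\<close>, are minimal when \<open>n \<ge> 5\<close>. The last one is free of \<open>x\<^sub>2\<close>, so the
  order of the ideal in \<open>x\<^sub>2\<close> is \<open>0\<close>, whereas the first two both have order \<open>1\<close> there.
  Genericity would therefore require a third minimal generator dividing their least common
  multiple \<open>x\<^sub>1x\<^sub>2x\<^sub>3x\<^sub>4\<close>. Since \<open>5\<close> is a neighbor of \<open>4\<close>, only the closed neighborhoods of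
  \<open>1\<close>, \<open>2\<close> and \<open>3\<close> are contained in \<open>{1, 2, 3, 4}\<close>, and the one of \<open>2\<close> properly contains
  that of \<open>1\<close>, so the corresponding generator is not minimal.

  The argument needs two facts on monomials in \<^const>\<open>poly_ring\<close>: the minimal monomials of
  an ideal generated by monomials are the minimal elements of the generating set
  (\<open>min_gens_Idl\<close>), and the product over \<open>A \<union> B\<close> is a least common multiple of the products
  over \<open>A\<close> and \<open>B\<close> among all polynomials (\<open>lcmof_prod_var\<close>), which ensures that
  \<^const>\<open>somelcm\<close> picks an actual least common multiple.
\<close>

section \<open>Divisibility by monomials\<close>

lemma single_divides_iff:
  fixes p :: "('v, 'k::field) mpoly"
  assumes p: "p \<in> carrier (poly_ring V)"
  shows "Poly_Mapping.single c 1 divides\<^bsub>poly_ring V\<^esub> p \<longleftrightarrow>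
    (\<forall>a \<in> Poly_Mapping.keys p. \<forall>v. Poly_Mapping.lookup c v \<le> Poly_Mapping.lookup a v)"
proof
  assume "Poly_Mapping.single c 1 divides\<^bsub>poly_ring V\<^esub> p"
  then obtain q where q: "p = Poly_Mapping.single c 1 * q"
    by (auto simp: factor_def)
  show "\<forall>a \<in> Poly_Mapping.keys p. \<forall>v. Poly_Mapping.lookup c v \<le> Poly_Mapping.lookup a v"
  proof
    fix a assume "a \<in> Poly_Mapping.keys p"
    then obtain b where "a = c + b"
      using keys_mult[of "Poly_Mapping.single c 1" q] q by auto
    then show "\<forall>v. Poly_Mapping.lookup c v \<le> Poly_Mapping.lookup a v"
      by (simp add: lookup_add)
  qed
next
  assume le: "\<forall>a \<in> Poly_Mapping.keys p. \<forall>v. Poly_Mapping.lookup c v \<le> Poly_Mapping.lookup a v"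
  interpret cring "poly_ring V :: ('v, 'k) mpoly ring"
    by (rule cring_poly_ring)
  define q where
    "q = (\<Sum>a \<in> Poly_Mapping.keys p. Poly_Mapping.single (a - c) (Poly_Mapping.lookup p a))"
  have shift: "c + (a - c) = a" if "a \<in> Poly_Mapping.keys p" for a
    using le that by (intro poly_mapping_eqI) (simp add: lookup_add lookup_minus)
  have "Poly_Mapping.single c 1 * q =
      (\<Sum>a \<in> Poly_Mapping.keys p. Poly_Mapping.single a (Poly_Mapping.lookup p a))"
    unfolding q_def sum_distrib_left by (rule sum.cong) (simp_all add: mult_single shift)
  also have "\<dots> = p"
    by (rule poly_mapping_eqI) (auto simp: lookup_sum lookup_single when_def in_keys_iff)
  finally have "p = Poly_Mapping.single c 1 * q"
    by simp
  moreover have "q \<in> carrier (poly_ring V)"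
    unfolding mem_poly_ring_iff
  proof
    fix b assume "b \<in> Poly_Mapping.keys q"
    then obtain a where a: "a \<in> Poly_Mapping.keys p"
      "b \<in> Poly_Mapping.keys (Poly_Mapping.single (a - c) (Poly_Mapping.lookup p a))"
      unfolding q_def by (auto dest!: subsetD[OF keys_sum])
    then have "b = a - c"
      by (auto split: if_splits)
    then have "Poly_Mapping.keys b \<subseteq> Poly_Mapping.keys a"
      by (auto simp: in_keys_iff lookup_minus)
    then show "Poly_Mapping.keys b \<subseteq> V"
      using a(1) p by (auto simp: mem_poly_ring_iff)
  qed
  ultimately show "Poly_Mapping.single c 1 divides\<^bsub>poly_ring V\<^esub> p"
    unfolding factor_def by auto
qed

lemma monomials_divides_antisym:
  fixes m m' :: "('v, 'k::field) mpoly"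
  assumes "m \<in> monomials V" "m' \<in> monomials V"
    "m divides\<^bsub>poly_ring V\<^esub> m'" "m' divides\<^bsub>poly_ring V\<^esub> m"
  shows "m = m'"
proof -
  obtain a b where ab: "m = Poly_Mapping.single a 1" "m' = Poly_Mapping.single b 1"
    "Poly_Mapping.keys a \<subseteq> V" "Poly_Mapping.keys b \<subseteq> V"
    using assms(1,2) by (auto simp: monomials_def)
  have "a = b"
    using assms(3,4) ab by (intro poly_mapping_eqI) (simp add: single_divides_single_iff antisym)
  then show ?thesis
    using ab by simp
qed

lemma min_gens_Idl:
  fixes S :: "('v, 'k::field) mpoly set"
  assumes S: "S \<subseteq> monomials V"
  shows "min_gens V (Idl\<^bsub>poly_ring V\<^esub> S) =
    {s \<in> S. \<forall>s' \<in> S. s' divides\<^bsub>poly_ring V\<^esub> s \<longrightarrow> s' = s}"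
proof -
  interpret cring "poly_ring V :: ('v, 'k) mpoly ring"
    by (rule cring_poly_ring)
  have S_Idl: "S \<subseteq> Idl\<^bsub>poly_ring V\<^esub> S"
    using S monomials_carrier by (intro genideal_self) blast
  show ?thesis
  proof (intro equalityI subsetI)
    fix s assume "s \<in> min_gens V (Idl\<^bsub>poly_ring V\<^esub> S)"
    then show "s \<in> {s \<in> S. \<forall>s' \<in> S. s' divides\<^bsub>poly_ring V\<^esub> s \<longrightarrow> s' = s}"
      using min_gens_least[OF S refl] S S_Idl by (auto simp: min_gens_def)
  next
    fix s assume s: "s \<in> {s \<in> S. \<forall>s' \<in> S. s' divides\<^bsub>poly_ring V\<^esub> s \<longrightarrow> s' = s}"
    have "m = s" if m: "m \<in> Idl\<^bsub>poly_ring V\<^esub> S" "m \<in> monomials V"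
      "m divides\<^bsub>poly_ring V\<^esub> s" for m
    proof -
      obtain s' where s': "s' \<in> S" "s' divides\<^bsub>poly_ring V\<^esub> m"
        using monomial_in_genideal[OF S m(2,1)] by blast
      then have "s' divides\<^bsub>poly_ring V\<^esub> s"
        using m(3) S monomials_carrier divides_trans by blast
      then have "s' = s"
        using s s'(1) by blast
      then show ?thesis
        using monomials_divides_antisym[OF m(2) _ m(3)] s' S by blast
    qed
    then show "s \<in> min_gens V (Idl\<^bsub>poly_ring V\<^esub> S)"
      using s S S_Idl by (auto simp: min_gens_def)
  qed
qed

section \<open>Squarefree monomials\<close>

lemma lookup_sum_single_1:
  assumes "finite A"
  shows "Poly_Mapping.lookup (\<Sum>y \<in> A. Poly_Mapping.single y (1::nat)) v = (if v \<in> A then 1 else 0)"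
  using assms by (simp add: lookup_sum lookup_single when_def)

lemma keys_sum_single_1:
  assumes "finite A"
  shows "Poly_Mapping.keys (\<Sum>y \<in> A. Poly_Mapping.single y (1::nat)) = A"
  using assms by (auto simp: in_keys_iff lookup_sum_single_1 simp del: One_nat_def split: if_splits)

lemma prod_var_eq_single:
  assumes "finite A"
  shows "(\<Prod>y \<in> A. var y :: ('v, 'k::field) mpoly) =
    Poly_Mapping.single (\<Sum>y \<in> A. Poly_Mapping.single y 1) 1"
  using assms by (induction A rule: finite_induct) (simp_all add: var_def mult_single)

lemma prod_var_divides_poly_iff:
  fixes p :: "('v, 'k::field) mpoly"
  assumes "finite A" "p \<in> carrier (poly_ring V)"
  shows "(\<Prod>y \<in> A. var y) divides\<^bsub>poly_ring V\<^esub> p \<longleftrightarrow>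
    (\<forall>a \<in> Poly_Mapping.keys p. A \<subseteq> Poly_Mapping.keys a)"
proof -
  have "(\<forall>v. Poly_Mapping.lookup (\<Sum>y \<in> A. Poly_Mapping.single y 1) v \<le> Poly_Mapping.lookup a v) \<longleftrightarrow>
      A \<subseteq> Poly_Mapping.keys a" for a :: "'v \<Rightarrow>\<^sub>0 nat"
  proof -
    have "(if v \<in> A then 1 else 0) \<le> Poly_Mapping.lookup a v \<longleftrightarrow>
        (v \<in> A \<longrightarrow> v \<in> Poly_Mapping.keys a)" for v
      by (simp add: in_keys_iff Suc_le_eq)
    then show ?thesis
      unfolding lookup_sum_single_1[OF assms(1)] by blast
  qed
  then show ?thesis
    unfolding prod_var_eq_single[OF assms(1)] single_divides_iff[OF assms(2)] by blast
qed

lemma prod_var_divides_iff: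
  assumes "finite A" "finite B" "B \<subseteq> V"
  shows "(\<Prod>y \<in> A. var y :: ('v, 'k::field) mpoly) divides\<^bsub>poly_ring V\<^esub> (\<Prod>y \<in> B. var y) \<longleftrightarrow>
    A \<subseteq> B"
proof -
  have "(\<Prod>y \<in> B. var y :: ('v, 'k) mpoly) \<in> carrier (poly_ring V)"
    using prod_var_monomials[OF assms(2,3)] monomials_carrier by blast
  from prod_var_divides_poly_iff[OF assms(1) this] show ?thesis
    using assms(2) keys_sum_single_1[OF assms(2)] by (simp add: prod_var_eq_single[of B])
qed

lemma prod_var_eq_iff:
  assumes "finite A" "finite B"
  shows "(\<Prod>y \<in> A. var y :: ('v, 'k::field) mpoly) = (\<Prod>y \<in> B. var y) \<longleftrightarrow> A = B"
proof
  assume "(\<Prod>y \<in> A. var y :: ('v, 'k) mpoly) = (\<Prod>y \<in> B. var y)"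
  then have "Poly_Mapping.keys (\<Prod>y \<in> A. var y :: ('v, 'k) mpoly) =
      Poly_Mapping.keys (\<Prod>y \<in> B. var y :: ('v, 'k) mpoly)"
    by (rule arg_cong)
  then have "(\<Sum>y \<in> A. Poly_Mapping.single y (1::nat)) = (\<Sum>y \<in> B. Poly_Mapping.single y 1)"
    unfolding prod_var_eq_single[OF assms(1)] prod_var_eq_single[OF assms(2)] by simp
  from arg_cong[OF this, of Poly_Mapping.keys] show "A = B"
    unfolding keys_sum_single_1[OF assms(1)] keys_sum_single_1[OF assms(2)] .
qed simp

lemma var_ord_prod_var:
  assumes "finite A" "A \<subseteq> V"
  shows "var_ord V v (\<Prod>y \<in> A. var y :: ('v, 'k::field) mpoly) = (if v \<in> A then 1 else 0)"
proof -
  have var_power: "var v ^ k = (Poly_Mapping.single (Poly_Mapping.single v k) 1 :: ('v, 'k) mpoly)"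
    for k
    by (induction k) (simp_all add: var_def mult_single flip: single_add)
  have "var v ^ k divides\<^bsub>poly_ring V\<^esub> (\<Prod>y \<in> A. var y :: ('v, 'k) mpoly) \<longleftrightarrow>
      k \<le> (if v \<in> A then 1 else 0)" for k
    using assms
    by (auto simp: var_power prod_var_eq_single single_divides_single_iff keys_sum_single_1
        lookup_sum_single_1 lookup_single when_def simp del: One_nat_def split: if_splits)
  then have "{k. var v ^ k divides\<^bsub>poly_ring V\<^esub> (\<Prod>y \<in> A. var y :: ('v, 'k) mpoly)} =
      {..if v \<in> A then 1 else 0}"
    by auto
  then show ?thesis
    unfolding var_ord_def by (simp only:) (rule Max_eqI; simp)
qed

lemma lcmof_prod_var:
  assumes "finite A" "finite B" "A \<subseteq> V" "B \<subseteq> V"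
  shows "(\<Prod>y \<in> A \<union> B. var y :: ('v, 'k::field) mpoly)
    lcmof\<^bsub>poly_ring V\<^esub> (\<Prod>y \<in> A. var y) (\<Prod>y \<in> B. var y)"
proof -
  have "(\<Prod>y \<in> A \<union> B. var y) divides\<^bsub>poly_ring V\<^esub> p"
    if p: "p \<in> carrier (poly_ring V)"
      "(\<Prod>y \<in> A. var y) divides\<^bsub>poly_ring V\<^esub> p" "(\<Prod>y \<in> B. var y) divides\<^bsub>poly_ring V\<^esub> p"
    for p :: "('v, 'k) mpoly"
    using p assms(1,2) by (simp add: prod_var_divides_poly_iff)
  then show ?thesis
    using assms by (auto simp: islcm_def prod_var_divides_iff)
qed

lemma somelcm_prod_var_divides:
  assumes "finite A" "finite B" "A \<subseteq> V" "B \<subseteq> V"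
  shows "somelcm (poly_ring V) (\<Prod>y \<in> A. var y :: ('v, 'k::field) mpoly) (\<Prod>y \<in> B. var y)
    divides\<^bsub>poly_ring V\<^esub> (\<Prod>y \<in> A \<union> B. var y)"
proof -
  let ?m = "\<Prod>y \<in> A. var y :: ('v, 'k) mpoly" and ?m' = "\<Prod>y \<in> B. var y :: ('v, 'k) mpoly"
    and ?l = "\<Prod>y \<in> A \<union> B. var y :: ('v, 'k) mpoly"
  have l: "?l \<in> carrier (poly_ring V)"
    using prod_var_monomials[of "A \<union> B" V] monomials_carrier assms by blast
  have "somelcm (poly_ring V) ?m ?m' \<in> carrier (poly_ring V) \<and>
      somelcm (poly_ring V) ?m ?m' lcmof\<^bsub>poly_ring V\<^esub> ?m ?m'"
    unfolding somelcm_def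
    by (rule someI[where x = ?l]) (use l lcmof_prod_var[OF assms] in blast)
  moreover have "?m divides\<^bsub>poly_ring V\<^esub> ?l" "?m' divides\<^bsub>poly_ring V\<^esub> ?l"
    using assms by (simp_all add: prod_var_divides_iff)
  ultimately show ?thesis
    using l by (auto simp: islcm_def)
qed

section \<open>Closed neighborhood ideals\<close>

lemma closed_nbhd_subset: "v \<in> fst G \<Longrightarrow> closed_nbhd G v \<subseteq> fst G"
  by (auto simp: closed_nbhd_def)

text \<open>Minimal generators correspond to inclusion-minimal closed neighborhoods.\<close>

lemma min_gens_closed_nbhd_ideal:
  assumes fin: "finite (fst G)"
  shows "min_gens (fst G) (closed_nbhd_ideal G :: ('v, 'k::field) mpoly set) =
    {\<Prod>y \<in> closed_nbhd G v. var y | v.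
       v \<in> fst G \<and> (\<forall>u \<in> fst G. closed_nbhd G u \<subseteq> closed_nbhd G v \<longrightarrow>
         closed_nbhd G u = closed_nbhd G v)}"
proof -
  let ?gen = "\<lambda>v. \<Prod>y \<in> closed_nbhd G v. var y :: ('v, 'k) mpoly"
  have finite_nbhd: "finite (closed_nbhd G v)" if "v \<in> fst G" for v
    using closed_nbhd_subset[OF that] fin by (rule finite_subset)
  have "?gen ` fst G \<subseteq> monomials (fst G)"
    by (intro image_subsetI prod_var_monomials finite_nbhd closed_nbhd_subset)
  then have "min_gens (fst G) (closed_nbhd_ideal G) =
      {s \<in> ?gen ` fst G. \<forall>s' \<in> ?gen ` fst G. s' divides\<^bsub>poly_ring (fst G)\<^esub> s \<longrightarrow> s' = s}"
    unfolding closed_nbhd_ideal_def by (rule min_gens_Idl)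
  moreover have "?gen u divides\<^bsub>poly_ring (fst G)\<^esub> ?gen v \<longleftrightarrow> closed_nbhd G u \<subseteq> closed_nbhd G v"
    "?gen u = ?gen v \<longleftrightarrow> closed_nbhd G u = closed_nbhd G v"
    if "u \<in> fst G" "v \<in> fst G" for u v
    using that
    by (simp_all add: prod_var_divides_iff prod_var_eq_iff finite_nbhd closed_nbhd_subset)
  ultimately show ?thesis
    by auto
qed

lemma closed_nbhd_path_graph:
  assumes "v \<in> {1..n}"
  shows "closed_nbhd (path_graph n) v = {u \<in> {1..n}. u \<le> v + 1 \<and> v \<le> u + 1}"
proof -
  have "{u, v} \<in> snd (path_graph n) \<longleftrightarrow> u = v + 1 \<or> v = u + 1" if "u \<in> {1..n}" for u
    using that assms by (auto simp: path_graph_def doubleton_eq_iff)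
  moreover have "fst (path_graph n) = {1..n}"
    by (simp add: path_graph_def)
  ultimately show ?thesis
    using assms unfolding closed_nbhd_def by force
qed

theorem proposition3p7:
  fixes n :: nat
  assumes "n \<ge> 5"
  shows "\<not> generic_ideal {1..n} (closed_nbhd_ideal (path_graph n) :: (nat, 'k::field) mpoly set)"
proof
  let ?V = "{1..n}" and ?I = "closed_nbhd_ideal (path_graph n) :: (nat, 'k) mpoly set"
  define P where "P A = (\<Prod>y \<in> A. var y :: (nat, 'k) mpoly)" for A
  define N where "N = closed_nbhd (path_graph n)"
  define minimal where "minimal v \<longleftrightarrow> (\<forall>u \<in> ?V. N u \<subseteq> N v \<longrightarrow> N u = N v)" for v
  interpret cring "poly_ring ?V :: (nat, 'k) mpoly ring"
    by (rule cring_poly_ring)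
  assume gen: "generic_ideal ?V ?I"
  have gens: "min_gens ?V ?I = {P (N v) | v. v \<in> ?V \<and> minimal v}"
    using min_gens_closed_nbhd_ideal[of "path_graph n", where 'k = 'k]
    by (simp add: path_graph_def N_def minimal_def P_def)
  have N: "N v = {u \<in> ?V. u \<le> v + 1 \<and> v \<le> u + 1}" if "v \<in> ?V" for v
    using closed_nbhd_path_graph[OF that] by (simp add: N_def)
  have N1: "N 1 = {1, 2}" and N3: "N 3 = {2, 3, 4}" and Nn: "N n = {n - 1, n}"
    and N2: "N 2 = {1, 2, 3}"
    using assms by (auto simp: N)
  have self: "v \<in> N v" if "v \<in> ?V" for v
    using that by (simp add: N)
  have up: "v + 1 \<in> N v" if "v \<in> ?V" "v + 1 \<in> ?V" for v
    using that by (simp add: N)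
  have down: "v - 1 \<in> N v" if "v \<in> ?V" "v - 1 \<in> ?V" for v
    using that by (simp add: N)
  have "minimal 1"
    unfolding minimal_def
  proof (intro ballI impI)
    fix u assume u: "u \<in> ?V" "N u \<subseteq> N 1"
    then have "u = 1 \<or> u = 2"
      using self N1 by blast
    then show "N u = N 1"
      using u N1 N2 by auto
  qed
  moreover have "minimal 3"
    unfolding minimal_def
  proof (intro ballI impI)
    fix u assume u: "u \<in> ?V" "N u \<subseteq> N 3"
    then have "u = 2 \<or> u = 3 \<or> u = 4"
      using self N3 by blast
    moreover have "1 \<in> N 2" "5 \<in> N 4"
      using N2 up[of 4] assms by auto
    ultimately show "N u = N 3"
      using u N3 by auto
  qed
  moreover have "minimal n"
    unfolding minimal_def
  proof (intro ballI impI)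
    fix u assume u: "u \<in> ?V" "N u \<subseteq> N n"
    then have "u = n - 1 \<or> u = n"
      using self Nn by blast
    moreover have "n - 2 \<in> N (n - 1)"
      using down[of "n - 1"] assms by (simp add: numeral_2_eq_2)
    then have "\<not> N (n - 1) \<subseteq> N n"
      using Nn assms by auto
    ultimately show "N u = N n"
      using u by auto
  qed
  moreover have "P (N v) \<in> min_gens ?V ?I" if "v \<in> ?V" "minimal v" for v
    using that gens by blast
  ultimately have "P (N 1) \<in> min_gens ?V ?I" "P (N 3) \<in> min_gens ?V ?I"
    "P (N n) \<in> min_gens ?V ?I"
    using assms by auto
  then have mem: "P {1, 2} \<in> min_gens ?V ?I" "P {2, 3, 4} \<in> min_gens ?V ?I"
    "P {n - 1, n} \<in> min_gens ?V ?I"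
    unfolding N1 N3 Nn .
  have subsets: "{1, 2} \<subseteq> ?V" "{2, 3, 4} \<subseteq> ?V" "{n - 1, n} \<subseteq> ?V"
    using assms by auto
  have var_ord_P: "var_ord ?V 2 (P A) = (if 2 \<in> A then 1 else 0)" if "finite A" "A \<subseteq> ?V" for A
    unfolding P_def using that by (rule var_ord_prod_var)
  have ord: "var_ord ?V 2 (P {1, 2}) = 1" "var_ord ?V 2 (P {2, 3, 4}) = 1"
    "var_ord ?V 2 (P {n - 1, n}) = 0"
    using assms by (simp_all add: var_ord_P[OF _ subsets(1)] var_ord_P[OF _ subsets(2)]
        var_ord_P[OF _ subsets(3)] del: One_nat_def)
  have "ideal_ord ?V 2 ?I \<le> var_ord ?V 2 (P {n - 1, n})"
    unfolding ideal_ord_def by (rule cINF_lower[OF _ mem(3)]) simp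
  then have ord_I: "ideal_ord ?V 2 ?I = 0"
    using ord(3) by simp
  have ne: "P {1, 2} \<noteq> P {2, 3, 4}"
    unfolding P_def by (subst prod_var_eq_iff) auto
  have "P {1, 2} \<noteq> P {2, 3, 4} \<and> var_ord ?V 2 (P {1, 2}) = var_ord ?V 2 (P {2, 3, 4}) \<and>
      ideal_ord ?V 2 ?I < var_ord ?V 2 (P {1, 2})"
    using ne unfolding ord ord_I by simp
  moreover have "2 \<in> ?V"
    using assms by simp
  ultimately have "\<exists>m \<in> min_gens ?V ?I - {P {1, 2}, P {2, 3, 4}}.
      m divides\<^bsub>poly_ring ?V\<^esub> somelcm (poly_ring ?V) (P {1, 2}) (P {2, 3, 4})"
    using gen mem(1,2) unfolding generic_ideal_def by blast
  then obtain m where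
    m: "m \<in> min_gens ?V ?I" "m \<noteq> P {1, 2}" "m \<noteq> P {2, 3, 4}"
      "m divides\<^bsub>poly_ring ?V\<^esub> somelcm (poly_ring ?V) (P {1, 2}) (P {2, 3, 4})"
    by blast
  obtain v where v: "m = P (N v)" "v \<in> ?V" "minimal v"
    using m(1) gens by blast
  have finite_N: "finite (N v)"
    using v(2) N by simp
  have "m \<in> carrier (poly_ring ?V)"
    using m(1) monomials_carrier by (auto simp: min_gens_def)
  then have "m divides\<^bsub>poly_ring ?V\<^esub> P ({1, 2} \<union> {2, 3, 4})"
    using divides_trans[OF m(4)] somelcm_prod_var_divides[OF _ _ subsets(1,2)]
    unfolding P_def by blast
  then have N_le: "N v \<subseteq> {1, 2} \<union> {2, 3, 4}"
    unfolding v(1) P_def using finite_N subsets by (subst (asm) prod_var_divides_iff) auto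
  have "v = 1 \<or> v = 2 \<or> v = 3 \<or> v = 4"
    using self[OF v(2)] N_le by blast
  moreover have "v \<noteq> 1" "v \<noteq> 3"
    using m(2,3) v(1) N1 N3 by metis+
  moreover have "v \<noteq> 2"
  proof
    assume "v = 2"
    then have "N 1 = N 2"
      using v(3) N1 N2 assms unfolding minimal_def by (elim ballE[of _ _ 1]) auto
    then show False
      unfolding N1 N2 by (auto simp: set_eq_iff)
  qed
  moreover have "v \<noteq> 4"
  proof
    assume "v = 4"
    then have "5 \<in> N v"
      using up[of 4] assms by simp
    then show False
      using N_le by auto
  qed
  ultimately show False
    by blast
qed

end
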